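(* Let $(X,\mathbb{F})$ be a non-autonomous dynamical system generated by a family $\mathbb{F}=(f_n)_{n\ge1}$ of homeomorphisms of $X$. Then $(X,\mathbb{F})$ is equicontinuous if and only if $Q(X,\mathbb{F})=\triangle$, where $\triangle=\{(x,x):x\in X\}$ is the diagonal of $X\times X$ (both notions taken with respect to the full, $\mathbb{Z}$-indexed, orbit).
   Context: $(X,d_X)$ is a compact metric space and $\mathbb{F}=(f_n)_{n\ge1}$ is a sequence of homeomorphisms of $X$. For $n\in\mathbb{N}$, $\omega_n=f_n\circ\cdots\circ f_1$, $\omega_{-n}=(\omega_n)^{-1}=f_1^{-1}\circ\cdots\circ f_n^{-1}$, and $\omega_0=\mathrm{id}$. Since the system is generated by homeomorphisms, the full orbit $\{\omega_n(x):n\in\mathbb{Z}\}$ of a point is considered. $(X,\mathbb{F})$ is equicontinuous if for every $\epsilon>0$ there is $\delta>0$ such that for all $x,y\in X$, $d_X(x,y)<\delta$ implies $d_X(\omega_n(x),\omega_n(y))<\epsilon$ for all $n\in\mathbb{Z}$. A pair $(x,y)\in X\times X$ is regionally proximal if for every $\epsilon>0$ and all neighborhoods $U$ of $x$ and $V$ of $y$ there are $z_1\in U$, $z_2\in V$ such that $\{n\in\mathbb{Z}: d_X(\omega_n(z_1),\omega_n(z_2))<\epsilon\}$ is non-empty. $Q(X,\mathbb{F})$ is the set of regionally proximal pairs. *)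

theory Defs
  imports "HOL-Analysis.Analysis"
begin

text \<open>
  The space is the whole type \<^typ>\<open>'a\<close>. A family \<open>(f\<^sub>n)\<close> with \<open>n \<ge> 1\<close> is a function on \<^typ>\<open>nat\<close>
  whose value at \<open>0\<close> is never used.
\<close>

primrec forward_iterate :: "(nat \<Rightarrow> 'a \<Rightarrow> 'a) \<Rightarrow> nat \<Rightarrow> 'a \<Rightarrow> 'a" where
  "forward_iterate f 0 = id"
| "forward_iterate f (Suc n) = f (Suc n) \<circ> forward_iterate f n"

text \<open>
  The negative iterate \<open>\<omega>\<^bsub>-n\<^esub>\<close> is the inverse of \<open>\<omega>\<^sub>n\<close>, that is \<open>f\<^sub>1\<^sup>-\<^sup>1 \<circ> \<dots> \<circ> f\<^sub>n\<^sup>-\<^sup>1\<close>. It is meaningful only when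
  the maps \<open>f\<^sub>1, f\<^sub>2, \<dots>\<close> are bijections.
\<close>

definition omega :: "(nat \<Rightarrow> 'a \<Rightarrow> 'a) \<Rightarrow> int \<Rightarrow> 'a \<Rightarrow> 'a" where
  "omega f k = (if 0 \<le> k then forward_iterate f (nat k) else inv (forward_iterate f (nat (- k))))"

definition equicontinuous_system :: "(nat \<Rightarrow> 'a::metric_space \<Rightarrow> 'a) \<Rightarrow> bool" where
  "equicontinuous_system f \<longleftrightarrow>
     (\<forall>\<epsilon>>0. \<exists>\<delta>>0. \<forall>x y. dist x y < \<delta> \<longrightarrow> (\<forall>n::int. dist (omega f n x) (omega f n y) < \<epsilon>))"

text \<open>A neighbourhood of \<open>x\<close> is any set having \<open>x\<close> in its interior; it need not be open.\<close>

definition regionally_proximal :: "(nat \<Rightarrow> 'a::metric_space \<Rightarrow> 'a) \<Rightarrow> 'a \<Rightarrow> 'a \<Rightarrow> bool" where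
  "regionally_proximal f x y \<longleftrightarrow>
     (\<forall>\<epsilon>>0. \<forall>U V. x \<in> interior U \<longrightarrow> y \<in> interior V \<longrightarrow>
        (\<exists>z1\<in>U. \<exists>z2\<in>V. {n::int. dist (omega f n z1) (omega f n z2) < \<epsilon>} \<noteq> {}))"

definition regionally_proximal_pairs :: "(nat \<Rightarrow> 'a::metric_space \<Rightarrow> 'a) \<Rightarrow> ('a \<times> 'a) set" where
  "regionally_proximal_pairs f = {(x, y). regionally_proximal f x y}"

end

(*
  Since omega (-n) inverts omega n, equicontinuity over the full orbit also controls the inverses:
  orbits of distinct points cannot come close, even after moving the points slightly.
  Conversely, if equicontinuity fails, nearby points are separated by a fixed distance at times n k;
  a limit of the separated images is an off-diagonal pair, and it is regionally proximal because
  the times -n k bring the images back together.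
*)

theory Submission
  imports Defs
begin

lemma bij_forward_iterate:
  assumes "\<And>n. n \<ge> 1 \<Longrightarrow> bij (f n)"
  shows "bij (forward_iterate f n)"
proof (induction n)
  case (Suc n)
  then show ?case
    using assms by (simp only: forward_iterate.simps) (intro bij_comp, simp_all)
qed (simp only: forward_iterate.simps bij_id)

text \<open>For \<open>k > 0\<close> injectivity of the forward iterate cancels \<open>inv\<close>
  on the left; for \<open>k < 0\<close> surjectivity cancels it on the right.\<close>

lemma omega_uminus_omega:
  assumes "\<And>n. n \<ge> 1 \<Longrightarrow> bij (f n)"
  shows "omega f (- k) (omega f k x) = x"
proof -
  have "bij (forward_iterate f n)" for n
    using assms by (rule bij_forward_iterate)
  then show ?thesis
    by (auto simp: omega_def bij_is_inj bij_is_surj surj_f_inv_f)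
qed

lemma regionally_proximal_refl: "regionally_proximal f x x"
  unfolding regionally_proximal_def
proof (intro allI impI)
  fix e :: real and U V :: "'a set"
  assume "0 < e" "x \<in> interior U" "x \<in> interior V"
  then show "\<exists>z1\<in>U. \<exists>z2\<in>V. {n. dist (omega f n z1) (omega f n z2) < e} \<noteq> {}"
    using interior_subset by (intro bexI[of _ x]) auto
qed

lemma equicontinuous_imp_not_regionally_proximal:
  assumes bij: "\<And>n. n \<ge> 1 \<Longrightarrow> bij (f n)"
    and equi: "equicontinuous_system f" and "x \<noteq> y"
  shows "\<not> regionally_proximal f x y"
proof
  assume rp: "regionally_proximal f x y"
  \<comment> \<open>A third, since the path from \<open>x\<close> to \<open>y\<close> through
    \<open>z1\<close> and \<open>z2\<close> has three pieces, each shorter than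
    \<open>e\<close>.\<close>
  define e where "e = dist x y / 3"
  have "e > 0" using \<open>x \<noteq> y\<close> by (simp add: e_def)
  with equi obtain d where "d > 0"
    and d: "\<And>u v n. dist u v < d \<Longrightarrow> dist (omega f n u) (omega f n v) < e"
    unfolding equicontinuous_system_def by metis
  have "x \<in> interior (ball x e)" "y \<in> interior (ball y e)"
    using \<open>e > 0\<close> by (auto simp: interior_open)
  \<comment> \<open>The tolerance for regional proximality is the equicontinuity modulus
    \<open>d\<close>, so that equicontinuity applies to the images at time \<open>n\<close>.\<close>
  then obtain z1 z2 n where z: "dist x z1 < e" "dist y z2 < e"
    and n: "dist (omega f n z1) (omega f n z2) < d"
    using rp \<open>d > 0\<close> unfolding regionally_proximal_def
    by (metis (mono_tags, lifting) Collect_empty_eq mem_ball)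
  \<comment> \<open>Equicontinuity at time \<open>- n\<close> carries the close images back to
    \<open>z1\<close> and \<open>z2\<close>.\<close>
  have "dist z1 z2 < e"
    using d[OF n, of "- n"] by (simp add: omega_uminus_omega[OF bij])
  moreover have "dist x y \<le> dist x z1 + dist z1 z2 + dist y z2"
    by (metis add.commute add_left_mono dist_commute dist_triangle dist_triangle_le)
  ultimately show False using z by (simp add: e_def)
qed

lemma not_equicontinuous_imp_regionally_proximal:
  fixes f :: "nat \<Rightarrow> 'a::metric_space \<Rightarrow> 'a"
  assumes compact: "compact (UNIV :: 'a set)"
    and bij: "\<And>n. n \<ge> 1 \<Longrightarrow> bij (f n)"
    and not_equi: "\<not> equicontinuous_system f"
  obtains a b where "a \<noteq> b" "regionally_proximal f a b"
proof -
  obtain e where "e > 0"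
    and e: "\<And>d. d > 0 \<Longrightarrow> \<exists>x y n. dist x y < d \<and> e \<le> dist (omega f n x) (omega f n y)"
    using not_equi unfolding equicontinuous_system_def by (meson not_less)
  have "\<exists>x y n. dist x y < inverse (real (Suc k)) \<and> e \<le> dist (omega f n x) (omega f n y)" for k
    by (rule e) simp
  then obtain x y n where close: "\<And>k. dist (x k) (y k) < inverse (real (Suc k))"
    and far: "\<And>k. e \<le> dist (omega f (n k) (x k)) (omega f (n k) (y k))"
    by metis
  define u where "u k = omega f (n k) (x k)" for k
  define v where "v k = omega f (n k) (y k)" for k
  have return: "omega f (- n k) (u k) = x k" "omega f (- n k) (v k) = y k" for k
    by (simp_all add: u_def v_def omega_uminus_omega[OF bij])
  \<comment> \<open>Working in the product gives a single subsequence along which both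
    \<open>u\<close> and \<open>v\<close> converge.\<close>
  have "seq_compact (UNIV \<times> UNIV :: ('a \<times> 'a) set)"
    using compact_Times[OF compact compact] compact_imp_seq_compact by blast
  then obtain p r where r: "strict_mono (r :: nat \<Rightarrow> nat)"
    and lim: "((\<lambda>k. (u k, v k)) \<circ> r) \<longlonglongrightarrow> p"
    by (rule seq_compactE[where f = "\<lambda>k. (u k, v k)"]) auto
  have u: "(\<lambda>k. u (r k)) \<longlonglongrightarrow> fst p" and v: "(\<lambda>k. v (r k)) \<longlonglongrightarrow> snd p"
    using tendsto_fst[OF lim] tendsto_snd[OF lim] by (simp_all add: o_def)
  \<comment> \<open>The non-strict bound in \<open>far\<close> survives the limit and keeps
    \<open>p\<close> off the diagonal.\<close>
  have "e \<le> dist (fst p) (snd p)"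
    using far by (intro LIMSEQ_le_const[OF tendsto_dist[OF u v]]) (auto simp: u_def v_def)
  with \<open>e > 0\<close> have "fst p \<noteq> snd p" by auto
  moreover have "regionally_proximal f (fst p) (snd p)"
    unfolding regionally_proximal_def
  proof (intro allI impI)
    fix \<epsilon> :: real and U V :: "'a set"
    assume "0 < \<epsilon>" and U: "fst p \<in> interior U" and V: "snd p \<in> interior V"
    \<comment> \<open>This sequence bounds the distance to which \<open>u (r k)\<close> and
      \<open>v (r k)\<close> return at time \<open>- n (r k)\<close>.\<close>
    have "(\<lambda>k. inverse (real (Suc (r k)))) \<longlonglongrightarrow> 0"
      using LIMSEQ_subseq_LIMSEQ[OF LIMSEQ_inverse_real_of_nat r] by (simp add: o_def)
    then have "\<forall>\<^sub>F k in sequentially. inverse (real (Suc (r k))) < \<epsilon>"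
      using \<open>0 < \<epsilon>\<close> by (rule order_tendstoD(2))
    moreover have "\<forall>\<^sub>F k in sequentially. u (r k) \<in> interior U"
      using u U by (intro topological_tendstoD) auto
    moreover have "\<forall>\<^sub>F k in sequentially. v (r k) \<in> interior V"
      using v V by (intro topological_tendstoD) auto
    ultimately have "\<forall>\<^sub>F k in sequentially.
        u (r k) \<in> interior U \<and> v (r k) \<in> interior V \<and> inverse (real (Suc (r k))) < \<epsilon>"
      by eventually_elim simp
    then obtain k where k: "u (r k) \<in> interior U" "v (r k) \<in> interior V"
      "inverse (real (Suc (r k))) < \<epsilon>"
      using eventually_happens'[OF sequentially_bot] by blast
    \<comment> \<open>The witnesses are \<open>u (r k)\<close> and \<open>v (r k)\<close>; by
      \<open>return\<close> the distance is that of \<open>x (r k)\<close> and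
      \<open>y (r k)\<close>.\<close>
    have "dist (omega f (- n (r k)) (u (r k))) (omega f (- n (r k)) (v (r k))) < \<epsilon>"
      using close[of "r k"] k(3) by (simp add: return)
    then show "\<exists>z1\<in>U. \<exists>z2\<in>V. {m. dist (omega f m z1) (omega f m z2) < \<epsilon>} \<noteq> {}"
      using k(1,2) interior_subset by blast
  qed
  ultimately show thesis by (rule that)
qed

theorem theorem3p2:
  fixes f :: "nat \<Rightarrow> 'a::metric_space \<Rightarrow> 'a"
  assumes "compact (UNIV :: 'a set)"
    and "\<And>n. n \<ge> 1 \<Longrightarrow> \<exists>g. homeomorphism UNIV UNIV (f n) g"
  shows "equicontinuous_system f \<longleftrightarrow> regionally_proximal_pairs f = {(x, x) | x. x \<in> UNIV}"
proof -
  have bij: "bij (f n)" if "n \<ge> 1" for n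
    using assms(2)[OF that] by (auto simp: homeomorphism_def intro: bij_betw_byWitness)
  show ?thesis
  proof
    assume "equicontinuous_system f"
    \<comment> \<open>Equicontinuity excludes the off-diagonal pairs; the diagonal ones are
      regionally proximal in any system.\<close>
    then show "regionally_proximal_pairs f = {(x, x) | x. x \<in> UNIV}"
      using equicontinuous_imp_not_regionally_proximal[of f, OF bij]
      by (auto simp: regionally_proximal_pairs_def regionally_proximal_refl)
  next
    assume "regionally_proximal_pairs f = {(x, x) | x. x \<in> UNIV}"
    then have "x = y" if "regionally_proximal f x y" for x y
      using that unfolding regionally_proximal_pairs_def by blast
    \<comment> \<open>By contraposition: a failure of equicontinuity would produce an off-diagonal
      pair.\<close>
    then show "equicontinuous_system f"
      using not_equicontinuous_imp_regionally_proximal[of f, OF assms(1) bij] by metis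
  qed
qed

end
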